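(* Let $(Y,Y^\diamond)$ be a norming dual pair such that every sequentially continuous linear map $(Y^\diamond,\sigma(Y^\diamond,Y))\to\mathbb R$ is continuous. Let $\{S(t)\}_{t\ge0}$ be a twin semigroup on $(Y,Y^\diamond)$, let $q\in Y$, and let $f:[0,T]\to\mathbb R$ be bounded and measurable. Then for each $t\in[0,T]$ the linear functional $$y^\diamond\mapsto\int_0^t y^\diamond S(t-\tau)q\,f(\tau)\,d\tau$$ on $Y^\diamond$ is represented by an element of $Y$: there is $u\in Y$ with $\langle y^\diamond,u\rangle=\int_0^t y^\diamond S(t-\tau)q\,f(\tau)\,d\tau$ for all $y^\diamond\in Y^\diamond$.
   Context: Banach spaces $Y,Y^\diamond$ (real) form a norming dual pair if there is a bilinear map $\langle\cdot,\cdot\rangle:Y^\diamond\times Y\to\mathbb R$ with $|\langle y^\diamond,y\rangle|\le M\|y^\diamond\|\|y\|$ for some $M\ge1$, $\|y\|=\sup\{|\langle y^\diamond,y\rangle|:\|y^\diamond\|\le1\}$ and $\|y^\diamond\|=\sup\{|\langle y^\diamond,y\rangle|:\|y\|\le1\}$. $\sigma(Y^\diamond,Y)$ is the weak topology on $Y^\diamond$ induced by $Y$. A twin operator $L$ is a bounded bilinear map $Y^\diamond\times Y\to\mathbb R$, $(y^\diamond,y)\mapsto y^\diamond Ly$, such that for each $y$ there is $Ly\in Y$ with $\langle y^\diamond,Ly\rangle=y^\diamond Ly$ for all $y^\diamond$, and for each $y^\diamond$ there is $y^\diamond L\in Y^\diamond$ with $\langle y^\diamond L,y\rangle=y^\diamond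 Ly$ for all $y$. Composition: $y^\diamond L_1L_2y:=\langle y^\diamond L_1,L_2y\rangle$. A twin semigroup is a family $\{S(t)\}_{t\ge0}$ of twin operators with: (i) $S(0)=I$, $S(t+s)=S(t)S(s)$; (ii) $|y^\diamond S(t)y|\le Me^{\omega t}\|y\|\|y^\diamond\|$ for some $M\ge1,\omega\in\mathbb R$; (iii) $t\mapsto y^\diamond S(t)y$ is measurable for all $y,y^\diamond$; (iv) for $\operatorname{Re}\lambda>\omega$ there is a twin operator $\overline S(\lambda)$ (on the complexification if $\lambda$ is non-real) with $y^\diamond\overline S(\lambda)y=\int_0^\infty e^{-\lambda t}y^\diamond S(t)y\,dt$. *)

theory Defs
  imports "HOL-Analysis.Analysis"
begin

definition norming_dual_pair :: "('d::banach \<Rightarrow> 'y::banach \<Rightarrow> real) \<Rightarrow> bool" where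
  "norming_dual_pair p \<longleftrightarrow>
     bilinear p \<and>
     (\<exists>M\<ge>1. \<forall>d y. \<bar>p d y\<bar> \<le> M * norm d * norm y) \<and>
     (\<forall>y. norm y = (SUP d\<in>{d. norm d \<le> 1}. \<bar>p d y\<bar>)) \<and>
     (\<forall>d. norm d = (SUP y\<in>{y. norm y \<le> 1}. \<bar>p d y\<bar>))"

text \<open>The coarsest topology on the left space for which all maps \<open>\<lambda>d. p d y\<close> are continuous.\<close>

definition weak_topology :: "('d \<Rightarrow> 'y \<Rightarrow> real) \<Rightarrow> 'd topology" where
  "weak_topology p = topology_generated_by {{d. p d y \<in> V} |y V. open V}"

definition sequentially_continuous :: "'d topology \<Rightarrow> ('d \<Rightarrow> real) \<Rightarrow> bool" where
  "sequentially_continuous X \<phi> \<longleftrightarrow>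
     (\<forall>x l. limitin X x l sequentially \<longrightarrow> (\<lambda>n. \<phi> (x n)) \<longlonglongrightarrow> \<phi> l)"

definition twin_operator ::
  "('d::banach \<Rightarrow> 'y::banach \<Rightarrow> real) \<Rightarrow> ('d \<Rightarrow> 'y \<Rightarrow> real) \<Rightarrow> bool" where
  "twin_operator p L \<longleftrightarrow>
     bounded_bilinear L \<and>
     (\<forall>y. \<exists>z. \<forall>d. p d z = L d y) \<and>
     (\<forall>d. \<exists>e. \<forall>y. p e y = L d y)"

text \<open>For a twin operator \<open>L\<close> on a norming dual pair, the elements selected by the two
  definite descriptions below exist, and they are unique because \<open>p\<close> separates points on both
  sides.\<close>

definition right_action :: "('d \<Rightarrow> 'y \<Rightarrow> real) \<Rightarrow> ('d \<Rightarrow> 'y \<Rightarrow> real) \<Rightarrow> 'y \<Rightarrow> 'y" where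
  "right_action p L y = (THE z. \<forall>d. p d z = L d y)"

definition left_action :: "('d \<Rightarrow> 'y \<Rightarrow> real) \<Rightarrow> ('d \<Rightarrow> 'y \<Rightarrow> real) \<Rightarrow> 'd \<Rightarrow> 'd" where
  "left_action p L d = (THE e. \<forall>y. p e y = L d y)"

definition twin_comp ::
  "('d \<Rightarrow> 'y \<Rightarrow> real) \<Rightarrow> ('d \<Rightarrow> 'y \<Rightarrow> real) \<Rightarrow> ('d \<Rightarrow> 'y \<Rightarrow> real) \<Rightarrow> 'd \<Rightarrow> 'y \<Rightarrow> real" where
  "twin_comp p L K d y = p (left_action p L d) (right_action p K y)"

text \<open>The complexification of a real Banach space is the product of two copies of it, where
  \<open>(a, b)\<close> stands for \<open>a + \<i> b\<close>. The product norm is equivalent to every admissible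
  complexification norm, so that boundedness has the usual meaning.\<close>

definition cscale :: "complex \<Rightarrow> 'a::real_vector \<times> 'a \<Rightarrow> 'a \<times> 'a" where
  "cscale c v = (Re c *\<^sub>R fst v - Im c *\<^sub>R snd v, Re c *\<^sub>R snd v + Im c *\<^sub>R fst v)"

text \<open>The complex bilinear (not sesquilinear) extension of a real bilinear form.\<close>

definition complexify ::
  "('d \<Rightarrow> 'y \<Rightarrow> real) \<Rightarrow> 'd \<times> 'd \<Rightarrow> 'y \<times> 'y \<Rightarrow> complex" where
  "complexify B d y = Complex (B (fst d) (fst y) - B (snd d) (snd y))
                              (B (fst d) (snd y) + B (snd d) (fst y))"

definition complex_twin_operator ::
  "('d::banach \<Rightarrow> 'y::banach \<Rightarrow> real) \<Rightarrow> ('d \<times> 'd \<Rightarrow> 'y \<times> 'y \<Rightarrow> complex) \<Rightarrow> bool" where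
  "complex_twin_operator p L \<longleftrightarrow>
     bounded_bilinear L \<and>
     (\<forall>c d y. L (cscale c d) y = c * L d y \<and> L d (cscale c y) = c * L d y) \<and>
     (\<forall>y. \<exists>z. \<forall>d. complexify p d z = L d y) \<and>
     (\<forall>d. \<exists>e. \<forall>y. complexify p e y = L d y)"

text \<open>Only the values \<open>S t\<close> with \<open>t \<ge> 0\<close> are constrained. The identity twin operator is \<open>p\<close>
  itself. Measurability is Lebesgue measurability, which every Borel measurable function
  satisfies.\<close>

definition twin_semigroup ::
  "('d::banach \<Rightarrow> 'y::banach \<Rightarrow> real) \<Rightarrow> (real \<Rightarrow> 'd \<Rightarrow> 'y \<Rightarrow> real) \<Rightarrow> bool" where
  "twin_semigroup p S \<longleftrightarrow>
     (\<forall>t\<ge>0. twin_operator p (S t)) \<and>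
     S 0 = p \<and>
     (\<forall>t\<ge>0. \<forall>s\<ge>0. S (t + s) = twin_comp p (S t) (S s)) \<and>
     (\<forall>d y. (\<lambda>t. S t d y) \<in> borel_measurable (lebesgue_on {0..})) \<and>
     (\<exists>M \<omega>. M \<ge> 1 \<and>
       (\<forall>t\<ge>0. \<forall>d y. \<bar>S t d y\<bar> \<le> M * exp (\<omega> * t) * norm y * norm d) \<and>
       (\<forall>z>\<omega>. \<exists>R. twin_operator p R \<and>
          (\<forall>d y. R d y = (LINT t:{0..}|lebesgue. exp (- z * t) * S t d y))) \<and>
       (\<forall>z::complex. Re z > \<omega> \<and> z \<notin> \<real> \<longrightarrow> (\<exists>R. complex_twin_operator p R \<and>
          (\<forall>d y. R d y =
             (LINT t:{0..}|lebesgue. exp (- z * of_real t) * complexify (S t) d y)))))"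

end

theory Submission
  imports Defs
begin

text \<open>The functional \<open>\<phi> d = \<integral>\<^sub>0\<^sup>t S (t - \<tau>) d q f \<tau> d\<tau>\<close> is represented by an element of \<open>'y\<close> as
  soon as it is continuous for the weak topology: near \<open>0\<close> such a functional is controlled by
  finitely many pairings \<open>\<lambda>d. p d y\<close>, so it vanishes on their common kernel and is a linear
  combination of them (\<open>weakly_continuous_imp_representable\<close>). By the assumption on the pair it
  suffices to prove that \<open>\<phi>\<close> is sequentially continuous. Along a weakly convergent sequence the
  integrand converges pointwise, since each \<open>S s\<close> with \<open>s \<ge> 0\<close> maps \<open>q\<close> into \<open>'y\<close> and
  \<open>S s d q = p d (S s q)\<close> is a pairing with a fixed vector. Weakly convergent sequences are
  norm bounded by the uniform boundedness principle and the norming property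
  (\<open>weakly_convergent_imp_bounded\<close>). The exponential bound on \<open>S\<close> then gives a constant
  majorant on \<open>[0, t]\<close>, and dominated convergence applies.\<close>

section \<open>Weakly convergent sequences are bounded\<close>

text \<open>By Baire's theorem one of the closed sets \<open>{y. \<forall>i. norm (A i y) \<le> k}\<close>, which cover a
  complete space, contains a ball; translating the ball to the origin costs a factor 2.\<close>

lemma uniform_boundedness:
  fixes A :: "'i \<Rightarrow> 'a::banach \<Rightarrow> 'b::real_normed_vector"
  assumes lin: "\<And>i. bounded_linear (A i)"
    and ptw: "\<And>y. bounded (range (\<lambda>i. A i y))"
  shows "\<exists>B. \<forall>i y. norm (A i y) \<le> B * norm y"
proof -
  define C where "C k = {y. \<forall>i. norm (A i y) \<le> real k}" for k
  have closed: "closed (C k)" for k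
  proof -
    have "C k = (\<Inter>i. {y. norm (A i y) \<le> real k})"
      by (auto simp: C_def)
    moreover have "closed {y. norm (A i y) \<le> real k}" for i
      by (intro closed_Collect_le continuous_intros linear_continuous_on lin)
    ultimately show ?thesis
      by auto
  qed
  have cover: "(\<Union>k. C k) = UNIV"
  proof -
    have "\<exists>k. y \<in> C k" for y
    proof -
      obtain b where b: "\<And>i. norm (A i y) \<le> b"
        using ptw[of y] by (auto simp: bounded_iff)
      obtain k where "b \<le> real k"
        using real_arch_simple by blast
      with b have "y \<in> C k"
        unfolding C_def by (auto intro: order_trans)
      then show ?thesis ..
    qed
    then show ?thesis by auto
  qed
  have "\<exists>k. interior (C k) \<noteq> {}"
  proof (rule ccontr)
    assume "\<nexists>k. interior (C k) \<noteq> {}"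
    then have "Met_TC.mtopology interior_of \<Union>(range C) = {}"
      using closed
      by (intro Met_TC.metric_Baire_category_alt) (auto simp: complete_UNIV)
    then show False
      using cover by simp
  qed
  then obtain k x where "x \<in> interior (C k)"
    by auto
  then obtain e where "e > 0" and e: "cball x e \<subseteq> C k"
    by (auto simp: mem_interior_cball)
  show ?thesis
  proof (intro exI[of _ "2 * real k / e"] allI)
    fix i y
    interpret bounded_linear "A i" by (rule lin)
    show "norm (A i y) \<le> 2 * real k / e * norm y"
    proof (cases "y = 0")
      case False
      define z where "z = (e / norm y) *\<^sub>R y"
      have "norm z = e"
        using False \<open>e > 0\<close> by (simp add: z_def)
      then have "x + z \<in> C k" "x \<in> C k"
        using e \<open>e > 0\<close> by (auto simp: dist_norm)
      then have *: "norm (A i (x + z)) \<le> real k" "norm (A i x) \<le> real k"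
        by (auto simp: C_def)
      have "A i z = A i (x + z) - A i x"
        by (simp add: add)
      then have "norm (A i z) \<le> 2 * real k"
        using * norm_triangle_ineq4[of "A i (x + z)" "A i x"] by simp
      then show ?thesis
        using False \<open>e > 0\<close> by (simp add: z_def scaleR field_simps)
    qed simp
  qed
qed

lemma weakly_convergent_imp_pairing_tendsto:
  assumes "limitin (weak_topology p) x l sequentially"
  shows "(\<lambda>n. p (x n) y) \<longlonglongrightarrow> p l y"
proof (rule topological_tendstoI)
  fix V :: "real set" assume "open V" "p l y \<in> V"
  then have "openin (weak_topology p) {d. p d y \<in> V}"
    unfolding weak_topology_def by (intro topology_generated_by_Basis) blast
  with assms \<open>p l y \<in> V\<close> show "\<forall>\<^sub>F n in sequentially. p (x n) y \<in> V"
    unfolding limitin_def by auto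
qed

text \<open>As functionals on the second space the \<open>x n\<close> are pointwise bounded, hence uniformly
  bounded; the norming property turns this into a bound on the norms.\<close>

lemma weakly_convergent_imp_bounded:
  fixes p :: "'d::banach \<Rightarrow> 'y::banach \<Rightarrow> real"
  assumes pair: "norming_dual_pair p"
    and lim: "limitin (weak_topology p) x l sequentially"
  shows "bounded (range x)"
proof -
  have "bilinear p"
    using pair by (simp add: norming_dual_pair_def)
  obtain M where M: "\<And>d y. \<bar>p d y\<bar> \<le> M * norm d * norm y"
    using pair unfolding norming_dual_pair_def by blast
  have "\<exists>B. \<forall>n y. norm (p (x n) y) \<le> B * norm y"
  proof (rule uniform_boundedness[of "\<lambda>n. p (x n)"])
    show "bounded_linear (p (x n))" for n
    proof (rule bounded_linear_intro)
      show "p (x n) (u + v) = p (x n) u + p (x n) v" for u v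
        using \<open>bilinear p\<close> by (rule bilinear_radd)
      show "p (x n) (c *\<^sub>R u) = c *\<^sub>R p (x n) u" for c u
        using \<open>bilinear p\<close> by (rule bilinear_rmul)
      show "norm (p (x n) u) \<le> norm u * (M * norm (x n))" for u
        using M[of "x n" u] by (simp add: mult.commute mult.left_commute)
    qed
    show "bounded (range (\<lambda>n. p (x n) y))" for y
      using weakly_convergent_imp_pairing_tendsto[OF lim]
      by (rule convergent_imp_bounded)
  qed
  then obtain B where B: "\<And>n y. norm (p (x n) y) \<le> B * norm y"
    by blast
  have "norm (x n) \<le> \<bar>B\<bar>" for n
  proof -
    have "norm (x n) = (SUP y\<in>{y. norm y \<le> 1}. \<bar>p (x n) y\<bar>)"
      using pair unfolding norming_dual_pair_def by blast
    also have "\<dots> \<le> \<bar>B\<bar>"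
    proof (rule cSUP_least)
      show "{y :: 'y. norm y \<le> 1} \<noteq> {}"
        by (auto intro: exI[of _ 0])
      fix y :: 'y assume y: "y \<in> {y. norm y \<le> 1}"
      have "\<bar>p (x n) y\<bar> \<le> B * norm y"
        using B[of n y] by simp
      also have "\<dots> \<le> \<bar>B\<bar> * 1"
        using y by (intro mult_mono) auto
      finally show "\<bar>p (x n) y\<bar> \<le> \<bar>B\<bar>" by simp
    qed
    finally show ?thesis .
  qed
  then show ?thesis
    by (auto simp: bounded_iff)
qed

section \<open>Weakly continuous functionals are pairings\<close>

text \<open>A subbasic open set contains the whole level set of one pairing through each of its points;
  finite intersections and unions preserve this with finitely many pairings.\<close>

lemma weakly_open_contains_finite_level_set:
  assumes "openin (weak_topology p) U" and "x \<in> U"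
  shows "\<exists>F. finite F \<and> (\<forall>d. (\<forall>y\<in>F. p d y = p x y) \<longrightarrow> d \<in> U)"
proof -
  have "generate_topology_on {{d. p d y \<in> V} |y V. open V} U"
    using assms(1) by (simp add: weak_topology_def openin_topology_generated_by_iff)
  then show ?thesis
    using \<open>x \<in> U\<close>
  proof induction
    case (Int a b)
    then obtain F G where "finite F" "\<forall>d. (\<forall>y\<in>F. p d y = p x y) \<longrightarrow> d \<in> a"
      and "finite G" "\<forall>d. (\<forall>y\<in>G. p d y = p x y) \<longrightarrow> d \<in> b"
      by blast
    then show ?case
      by (intro exI[of _ "F \<union> G"]) auto
  next
    case (UN K)
    then show ?case by (meson UnionE UnionI)
  next
    case (Basis s)
    then obtain y V where "s = {d. p d y \<in> V}" by blast
    with Basis.prems show ?case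
      by (intro exI[of _ "{y}"]) auto
  qed simp
qed

text \<open>Induction on the number of pairings: if \<open>\<phi>\<close> does not already vanish on the common
  kernel of the others, subtracting a multiple of the remaining pairing makes it vanish there.\<close>

lemma vanishing_on_common_kernel_imp_representable:
  fixes p :: "'d::real_vector \<Rightarrow> 'y::real_vector \<Rightarrow> real"
  assumes "finite F" and "bilinear p" and "linear \<phi>"
    and "\<And>d. (\<And>y. y \<in> F \<Longrightarrow> p d y = 0) \<Longrightarrow> \<phi> d = 0"
  shows "\<exists>u. \<forall>d. \<phi> d = p d u"
  using assms(1,3,4)
proof (induction F arbitrary: \<phi> rule: finite_induct)
  case empty
  then show ?case
    by (intro exI[of _ 0]) (simp add: bilinear_rzero[OF \<open>bilinear p\<close>])
next
  case (insert y F)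
  note lin = linear_add[OF insert.prems(1)] linear_diff[OF insert.prems(1)]
    linear_cmul[OF insert.prems(1)]
  note bil = bilinear_ladd[OF \<open>bilinear p\<close>] bilinear_lsub[OF \<open>bilinear p\<close>]
    bilinear_lmul[OF \<open>bilinear p\<close>] bilinear_radd[OF \<open>bilinear p\<close>] bilinear_rmul[OF \<open>bilinear p\<close>]
  show ?case
  proof (cases "\<forall>d. (\<forall>z\<in>F. p d z = 0) \<longrightarrow> \<phi> d = 0")
    case True
    then show ?thesis
      using insert.IH[OF insert.prems(1)] by blast
  next
    case False
    then obtain d0 where d0: "\<And>z. z \<in> F \<Longrightarrow> p d0 z = 0" and "\<phi> d0 \<noteq> 0"
      by blast
    then have nz: "p d0 y \<noteq> 0"
      using insert.prems(2)[of d0] by auto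
    define c where "c = \<phi> d0 / p d0 y"
    have "\<exists>u. \<forall>d. \<phi> d - c * p d y = p d u"
    proof (rule insert.IH)
      show "linear (\<lambda>d. \<phi> d - c * p d y)"
        by (rule linearI) (simp_all add: lin bil algebra_simps)
      fix d assume d: "\<And>z. z \<in> F \<Longrightarrow> p d z = 0"
      have "\<phi> (d - (p d y / p d0 y) *\<^sub>R d0) = 0"
        using d d0 nz by (intro insert.prems(2)) (auto simp: bil)
      then show "\<phi> d - c * p d y = 0"
        by (simp add: lin c_def)
    qed
    then obtain u where "\<And>d. \<phi> d - c * p d y = p d u"
      by blast
    then have "\<phi> d = p d (u + c *\<^sub>R y)" for d
      by (simp add: bil) (metis diff_add_cancel)
    then show ?thesis by blast
  qed
qed

text \<open>The open set \<open>{d. \<bar>\<phi> d\<bar> < 1}\<close> contains the common kernel of finitely many pairings, and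
  a linear functional that is bounded on a subspace vanishes there.\<close>

lemma weakly_continuous_imp_representable:
  fixes p :: "'d::real_vector \<Rightarrow> 'y::real_vector \<Rightarrow> real"
  assumes "bilinear p" and "linear \<phi>"
    and cont: "continuous_map (weak_topology p) euclideanreal \<phi>"
  shows "\<exists>u. \<forall>d. \<phi> d = p d u"
proof -
  have "UNIV = {d. p d 0 \<in> UNIV}" by simp
  then have "openin (weak_topology p) UNIV"
    unfolding weak_topology_def by (intro topology_generated_by_Basis) blast
  then have top: "topspace (weak_topology p) = UNIV"
    using openin_subset by blast
  have "openin (weak_topology p) {d \<in> topspace (weak_topology p). \<phi> d \<in> ball 0 1}"
    using cont by (rule openin_continuous_map_preimage) simp
  then have "openin (weak_topology p) {d. \<bar>\<phi> d\<bar> < 1}"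
    by (simp add: top)
  from weakly_open_contains_finite_level_set[OF this, of 0] obtain F where "finite F"
    and F: "\<And>d. (\<And>y. y \<in> F \<Longrightarrow> p d y = p 0 y) \<Longrightarrow> \<bar>\<phi> d\<bar> < 1"
    by (auto simp: linear_0[OF \<open>linear \<phi>\<close>])
  show ?thesis
  proof (rule vanishing_on_common_kernel_imp_representable[OF \<open>finite F\<close> \<open>bilinear p\<close> \<open>linear \<phi>\<close>])
    fix d assume d: "\<And>y. y \<in> F \<Longrightarrow> p d y = 0"
    show "\<phi> d = 0"
    proof (rule ccontr)
      assume nz: "\<phi> d \<noteq> 0"
      have "\<bar>\<phi> ((1 / \<phi> d) *\<^sub>R d)\<bar> < 1"
        by (rule F) (simp add: d bilinear_lmul[OF \<open>bilinear p\<close>] bilinear_lzero[OF \<open>bilinear p\<close>])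
      then show False
        using nz by (simp add: linear_cmul[OF \<open>linear \<phi>\<close>])
    qed
  qed
qed

section \<open>Convolution with a twin semigroup\<close>

text \<open>Extension by zero turns \<open>g\<close> and \<open>f\<close> into functions on the whole line, where
  composition with the reflection \<open>\<tau> \<mapsto> t - \<tau>\<close> preserves Lebesgue measurability; on
  \<open>[0, t]\<close> the extensions do not change the integrand.\<close>

lemma convolution_integrand_measurable:
  fixes g f :: "real \<Rightarrow> real"
  assumes g: "g \<in> borel_measurable (lebesgue_on {0..})"
    and f: "f \<in> borel_measurable (lebesgue_on {0..T})"
    and "t \<le> T"
  shows "(\<lambda>\<tau>. indicator {0..t} \<tau> *\<^sub>R (g (t - \<tau>) * f \<tau>)) \<in> borel_measurable lebesgue"
proof -
  let ?g = "\<lambda>s. if s \<in> {0..} then g s else 0" and ?f = "\<lambda>s. if s \<in> {0..T} then f s else 0"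
  have g': "?g \<in> borel_measurable lebesgue" and f': "?f \<in> borel_measurable lebesgue"
    using g f by (intro borel_measurable_if_I; simp)+
  have reflection: "(\<lambda>\<tau>. t - \<tau>) \<in> lebesgue \<rightarrow>\<^sub>M lebesgue"
    using lebesgue_affine_measurable[where c = "\<lambda>_::real. -1" and t = t] by simp
  have "(\<lambda>\<tau>. ?g (t - \<tau>)) \<in> borel_measurable lebesgue"
    using reflection g' by (rule measurable_compose)
  then have "(\<lambda>\<tau>. indicator {0..t} \<tau> * (?g (t - \<tau>) * ?f \<tau>)) \<in> borel_measurable lebesgue"
    using f' by (intro borel_measurable_times borel_measurable_indicator) simp
  also have "(\<lambda>\<tau>. indicator {0..t} \<tau> * (?g (t - \<tau>) * ?f \<tau>))
      = (\<lambda>\<tau>. indicator {0..t} \<tau> *\<^sub>R (g (t - \<tau>) * f \<tau>))"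
    using \<open>t \<le> T\<close> by (auto simp: fun_eq_iff indicator_def)
  finally show ?thesis .
qed

theorem lemma5p2:
  fixes p :: "'d::banach \<Rightarrow> 'y::banach \<Rightarrow> real"
    and S :: "real \<Rightarrow> 'd \<Rightarrow> 'y \<Rightarrow> real"
    and q :: 'y and f :: "real \<Rightarrow> real" and T t :: real
  assumes "norming_dual_pair p"
    and "\<And>\<phi> :: 'd \<Rightarrow> real. linear \<phi> \<Longrightarrow> sequentially_continuous (weak_topology p) \<phi>
           \<Longrightarrow> continuous_map (weak_topology p) euclideanreal \<phi>"
    and "twin_semigroup p S"
    and "bounded (f ` {0..T})"
    and "f \<in> borel_measurable (lebesgue_on {0..T})"
    and "t \<in> {0..T}"
  shows "\<exists>u. \<forall>d. p d u = (LINT \<tau>:{0..t}|lebesgue. S (t - \<tau>) d q * f \<tau>)"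
proof -
  define h where "h d \<tau> = indicator {0..t} \<tau> *\<^sub>R (S (t - \<tau>) d q * f \<tau>)" for d \<tau>
  define \<phi> where "\<phi> d = integral\<^sup>L lebesgue (h d)" for d
  have \<phi>_eq: "\<phi> d = (LINT \<tau>:{0..t}|lebesgue. S (t - \<tau>) d q * f \<tau>)" for d
    unfolding \<phi>_def h_def set_lebesgue_integral_def ..
  have "bilinear p"
    using assms(1) by (simp add: norming_dual_pair_def)
  have twin: "twin_operator p (S s)" if "s \<ge> 0" for s
    using assms(3) that by (simp add: twin_semigroup_def)
  have bil: "bounded_bilinear (S s)" if "s \<ge> 0" for s
    using twin[OF that] by (simp add: twin_operator_def)
  have meas [measurable]: "h d \<in> borel_measurable lebesgue" for d
    unfolding h_def using assms(3,5,6)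
    by (intro convolution_integrand_measurable[where T = T]) (auto simp: twin_semigroup_def)
  have "\<exists>M \<omega>. M \<ge> 1 \<and> (\<forall>s\<ge>0. \<forall>d y. \<bar>S s d y\<bar> \<le> M * exp (\<omega> * s) * norm y * norm d)"
    using assms(3) unfolding twin_semigroup_def
    by (elim conjE exE) (intro exI conjI; assumption)
  then obtain M \<omega> where "M \<ge> 1"
    and growth: "\<And>s d y. s \<ge> 0 \<Longrightarrow> \<bar>S s d y\<bar> \<le> M * exp (\<omega> * s) * norm y * norm d"
    by blast
  obtain K where K: "\<And>\<tau>. \<tau> \<in> {0..T} \<Longrightarrow> \<bar>f \<tau>\<bar> \<le> K"
    using assms(4) unfolding bounded_iff by force
  have "0 \<le> K"
    using K[of t] assms(6) by simp
  define C where "C = M * exp (\<bar>\<omega>\<bar> * t) * norm q * K"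
  have majorant: "norm (h d \<tau>) \<le> indicator {0..t} \<tau> *\<^sub>R (C * norm d)" for d \<tau>
  proof (cases "\<tau> \<in> {0..t}")
    case True
    have "\<omega> * (t - \<tau>) \<le> \<bar>\<omega>\<bar> * t"
      using True by (intro mult_mono) auto
    then have "M * exp (\<omega> * (t - \<tau>)) * norm q * norm d \<le> M * exp (\<bar>\<omega>\<bar> * t) * norm q * norm d"
      using \<open>M \<ge> 1\<close> by (intro mult_right_mono mult_left_mono) auto
    then have "\<bar>S (t - \<tau>) d q\<bar> \<le> M * exp (\<bar>\<omega>\<bar> * t) * norm q * norm d"
      using growth[of "t - \<tau>" d q] True by auto
    moreover have "\<bar>f \<tau>\<bar> \<le> K"
      using True assms(6) by (intro K) auto
    ultimately have "\<bar>S (t - \<tau>) d q\<bar> * \<bar>f \<tau>\<bar> \<le> (M * exp (\<bar>\<omega>\<bar> * t) * norm q * norm d) * K"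
      using \<open>0 \<le> K\<close> \<open>M \<ge> 1\<close> by (intro mult_mono) auto
    then show ?thesis
      using True by (simp add: h_def C_def abs_mult mult_ac)
  qed (simp add: h_def)
  have int_const: "integrable lebesgue (\<lambda>\<tau>. indicator {0..t} \<tau> *\<^sub>R c)" for c :: real
    by (rule integrableI_bounded_set_indicator[where B = "\<bar>c\<bar>"])
       (use assms(6) in auto)
  have int: "integrable lebesgue (h d)" for d
    using majorant[of d]
    by (intro Bochner_Integration.integrable_bound[OF int_const[of "C * norm d"] meas])
       (auto intro: order_trans[OF _ abs_ge_self])
  have "linear \<phi>"
  proof (rule linearI)
    fix a b :: 'd and c :: real
    have "h (a + b) = (\<lambda>\<tau>. h a \<tau> + h b \<tau>)"
      by (auto simp: fun_eq_iff h_def indicator_def bounded_bilinear.add_left[OF bil] algebra_simps)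
    then show "\<phi> (a + b) = \<phi> a + \<phi> b"
      unfolding \<phi>_def using int by simp
    have "h (c *\<^sub>R a) = (\<lambda>\<tau>. c * h a \<tau>)"
      by (auto simp: fun_eq_iff h_def indicator_def bounded_bilinear.scaleR_left[OF bil])
    then show "\<phi> (c *\<^sub>R a) = c *\<^sub>R \<phi> a"
      unfolding \<phi>_def by simp
  qed
  have "sequentially_continuous (weak_topology p) \<phi>"
    unfolding sequentially_continuous_def
  proof (intro allI impI)
    fix x l assume lim: "limitin (weak_topology p) x l sequentially"
    obtain B where B: "\<And>n. norm (x n) \<le> B"
      using weakly_convergent_imp_bounded[OF assms(1) lim] by (auto simp: bounded_iff)
    have "0 \<le> C"
      using \<open>0 \<le> K\<close> \<open>M \<ge> 1\<close> by (simp add: C_def)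
    have ptw: "(\<lambda>n. h (x n) \<tau>) \<longlonglongrightarrow> h l \<tau>" for \<tau>
    proof (cases "\<tau> \<in> {0..t}")
      case True
      obtain z where z: "\<And>d. p d z = S (t - \<tau>) d q"
        using twin[of "t - \<tau>"] True unfolding twin_operator_def by fastforce
      have "(\<lambda>n. S (t - \<tau>) (x n) q) \<longlonglongrightarrow> S (t - \<tau>) l q"
        using weakly_convergent_imp_pairing_tendsto[OF lim, of z] by (simp add: z)
      then show ?thesis
        unfolding h_def by (intro tendsto_intros)
    qed (simp add: h_def)
    have dom: "norm (h (x n) \<tau>) \<le> indicator {0..t} \<tau> *\<^sub>R (C * B)" for n \<tau>
      using majorant[of "x n" \<tau>] mult_left_mono[OF B[of n] \<open>0 \<le> C\<close>]
      by (auto simp: indicator_def split: if_splits)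
    show "(\<lambda>n. \<phi> (x n)) \<longlonglongrightarrow> \<phi> l"
      unfolding \<phi>_def using ptw dom
      by (intro integral_dominated_convergence[OF meas meas int_const[of "C * B"]] AE_I2)
  qed
  then have "continuous_map (weak_topology p) euclideanreal \<phi>"
    using \<open>linear \<phi>\<close> by (rule assms(2)[rotated])
  then obtain u where "\<And>d. \<phi> d = p d u"
    using weakly_continuous_imp_representable[OF \<open>bilinear p\<close> \<open>linear \<phi>\<close>] by blast
  then show ?thesis
    using \<phi>_eq by metis
qed

end
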